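(* For any $\alpha\in(0,1/4)$ and $\epsilon_{\max}\in[0,1/2]$ there exists a constant $c>0$ depending only on $\alpha$ and $\epsilon_{\max}$ such that for all integers $n\ge3$ satisfying $\epsilon_{\max}\ge\frac{2\alpha}n$, all $\epsilon\in[0,\epsilon_{\max}]$ and all $\lambda\ge0$, $$r_\alpha(\epsilon,\lambda,\epsilon_{\max})\ \ge\ c\left(\left[\left(\sqrt\lambda\Big(\frac1{\sqrt{\log n}}+\frac1{\sqrt{\log(1/\epsilon)}}\Big)+1\right)\wedge\lambda\right]+\frac1n+\epsilon\right).$$
   Context: For $\epsilon\in[0,1]$, $\lambda\ge0$ and a probability distribution $Q$ on $\mathbb R$ put $P_{\epsilon,\lambda,Q}=(1-\epsilon)\,\mathrm{Poisson}(\lambda)+\epsilon Q$. The data $X_1,\dots,X_n$ are i.i.d. from $P_{\epsilon,\lambda,Q}$, and $P_{\epsilon,\lambda,Q}(E)$ denotes the probability of an event $E$ about $(X_1,\dots,X_n)$ under $P_{\epsilon,\lambda,Q}^{\otimes n}$. Suprema and infima over $Q$ range over all probability distributions, over $\lambda$ over $[0,\infty)$. Write $a\wedge b=\min\{a,b\}$. An interval $[L,U]$ has length $|[L,U]|=U-L$ if $U\ge L$, and is empty (of length $0$) if $U<L$. Convention: $1/\sqrt{\log(1/\epsilon)}=0$ for $\epsilon=0$. Class of confidence intervals: $$\mathcal I_\alpha(\epsilon_{\max})=\Big\{\widehat{\mathrm{CI}}=[l(\{X_i\}_{i=1}^n),u(\{X_i\}_{i=1}^n)]:\ \inf_{\lambda,Q}P_{\epsilon_{\max},\lambda,Q}\big(\lambda\in\widehat{\mathrm{CI}}\big)\ge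 1-\alpha\Big\}.$$ Locally optimal length: $$r_\alpha(\epsilon,\lambda,\epsilon_{\max})=\inf\Big\{r\ge0:\ \inf_{\widehat{\mathrm{CI}}\in\mathcal I_\alpha(\epsilon_{\max})}\ \sup_Q P_{\epsilon,\lambda,Q}\big(|\widehat{\mathrm{CI}}|\ge r\big)\le\alpha\Big\}.$$ *)

theory Defs
  imports "HOL-Probability.Probability"
begin

text \<open>
  The library's \<open>poisson_pmf\<close> is only specified for a positive rate; at rate \<open>0\<close>
  the Poisson distribution is the point mass at \<open>0\<close>.
\<close>

definition poisson0_pmf :: "real \<Rightarrow> nat pmf" where
  "poisson0_pmf lam = (if lam > 0 then poisson_pmf lam else return_pmf 0)"

lemma pmf_poisson0:
  assumes "lam \<ge> 0"
  shows "pmf (poisson0_pmf lam) k = lam ^ k / fact k * exp (-lam)"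
proof (cases "lam > 0")
  case True
  then show ?thesis by (simp add: poisson0_pmf_def)
next
  case False
  with assms have "lam = 0" by simp
  then show ?thesis by (cases k) (simp_all add: poisson0_pmf_def)
qed

definition poisson_measure :: "real \<Rightarrow> real measure" where
  "poisson_measure lam = distr (measure_pmf (poisson0_pmf lam)) borel real"

definition real_distributions :: "real measure set" where
  "real_distributions = {Q. prob_space Q \<and> sets Q = sets borel}"

lemma poisson_measure_in_distributions: "poisson_measure lam \<in> real_distributions"
  by (auto simp: real_distributions_def poisson_measure_def
      intro!: prob_space.prob_space_distr prob_space_measure_pmf)

definition contaminated :: "real \<Rightarrow> real \<Rightarrow> real measure \<Rightarrow> real measure" where
  "contaminated \<epsilon> lam Q = measure_of UNIV (sets borel)
     (\<lambda>A. ennreal (1 - \<epsilon>) * emeasure (poisson_measure lam) A + ennreal \<epsilon> * emeasure Q A)"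

lemma sets_contaminated [simp, measurable_cong]: "sets (contaminated \<epsilon> lam Q) = sets borel"
  by (simp add: contaminated_def flip: space_borel)

lemma space_contaminated [simp]: "space (contaminated \<epsilon> lam Q) = UNIV"
  by (simp add: contaminated_def)

lemma emeasure_contaminated:
  assumes Q: "Q \<in> real_distributions" and A: "A \<in> sets borel"
  shows "emeasure (contaminated \<epsilon> lam Q) A =
    ennreal (1 - \<epsilon>) * emeasure (poisson_measure lam) A + ennreal \<epsilon> * emeasure Q A"
    (is "_ = ?\<mu> A")
  unfolding contaminated_def
proof (rule emeasure_measure_of_sigma)
  show "sigma_algebra UNIV (sets (borel :: real measure))"
    using sets.sigma_algebra_axioms[of "borel :: real measure"] by simp
  show "positive (sets borel) ?\<mu>" by (simp add: positive_def)
  have *: "sets Q = sets borel" "sets (poisson_measure lam) = sets borel"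
    using Q by (auto simp: real_distributions_def poisson_measure_def)
  show "countably_additive (sets borel) ?\<mu>"
  proof (rule countably_additiveI)
    fix B :: "nat \<Rightarrow> real set"
    assume B: "range B \<subseteq> sets borel" "disjoint_family B"
    have "(\<Sum>i. ?\<mu> (B i)) = ennreal (1 - \<epsilon>) * (\<Sum>i. emeasure (poisson_measure lam) (B i))
        + ennreal \<epsilon> * (\<Sum>i. emeasure Q (B i))"
      by (subst suminf_add[symmetric]) (auto intro: summableI)
    also have "\<dots> = ?\<mu> (\<Union>i. B i)"
      using B * by (simp add: suminf_emeasure)
    finally show "(\<Sum>i. ?\<mu> (B i)) = ?\<mu> (\<Union>i. B i)" .
  qed
qed (fact A)

lemma contaminated_in_distributions:
  assumes Q: "Q \<in> real_distributions" and \<epsilon>: "0 \<le> \<epsilon>" "\<epsilon> \<le> 1"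
  shows "contaminated \<epsilon> lam Q \<in> real_distributions"
proof -
  have one: "emeasure P UNIV = 1" if "P \<in> real_distributions" for P
    using that prob_space.emeasure_space_1[of P] sets_eq_imp_space_eq[of P borel]
    by (simp add: real_distributions_def)
  have "emeasure (contaminated \<epsilon> lam Q) UNIV = ennreal (1 - \<epsilon>) + ennreal \<epsilon>"
    using Q by (simp add: emeasure_contaminated one poisson_measure_in_distributions)
  also have "\<dots> = 1"
    using \<epsilon> by (simp flip: ennreal_plus)
  finally show ?thesis
    by (auto simp: real_distributions_def intro!: prob_spaceI)
qed

definition sample_measure :: "nat \<Rightarrow> real \<Rightarrow> real \<Rightarrow> real measure \<Rightarrow> (nat \<Rightarrow> real) measure" where
  "sample_measure n \<epsilon> lam Q = Pi\<^sub>M {..<n} (\<lambda>_. contaminated \<epsilon> lam Q)"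

definition interval_length :: "real \<Rightarrow> real \<Rightarrow> real" where
  "interval_length L U = (if U \<ge> L then U - L else 0)"

text \<open>
  A confidence interval is the pair of its endpoint functions, which are measurable functions
  of the sample. Probabilities are taken in \<^typ>\<open>ennreal\<close>, so that infima and suprema are
  those of a complete lattice (in particular an infimum over the empty set is \<open>\<infinity>\<close>).
\<close>

definition confidence_intervals ::
    "nat \<Rightarrow> real \<Rightarrow> real \<Rightarrow> (((nat \<Rightarrow> real) \<Rightarrow> real) \<times> ((nat \<Rightarrow> real) \<Rightarrow> real)) set" where
  "confidence_intervals n \<alpha> \<epsilon>max = {(l, u).
     l \<in> borel_measurable (Pi\<^sub>M {..<n} (\<lambda>_. borel)) \<and>
     u \<in> borel_measurable (Pi\<^sub>M {..<n} (\<lambda>_. borel)) \<and>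
     (INF lam\<in>{0..}. INF Q\<in>real_distributions.
        emeasure (sample_measure n \<epsilon>max lam Q)
          {x \<in> space (sample_measure n \<epsilon>max lam Q). lam \<in> {l x..u x}}) \<ge> ennreal (1 - \<alpha>)}"

text \<open>The value is \<open>\<infinity>\<close> if no admissible \<open>r\<close> exists.\<close>

definition optimal_length :: "nat \<Rightarrow> real \<Rightarrow> real \<Rightarrow> real \<Rightarrow> real \<Rightarrow> ereal" where
  "optimal_length n \<alpha> \<epsilon> lam \<epsilon>max = Inf {ereal r | r. r \<ge> 0 \<and>
     (INF (l, u)\<in>confidence_intervals n \<alpha> \<epsilon>max. SUP Q\<in>real_distributions.
        emeasure (sample_measure n \<epsilon> lam Q)
          {x \<in> space (sample_measure n \<epsilon> lam Q). interval_length (l x) (u x) \<ge> r}) \<le> ennreal \<alpha>}"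

text \<open>The quantity \<open>1 / sqrt (log (1 / \<epsilon>))\<close>, read as \<open>0\<close> at \<open>\<epsilon> = 0\<close>.\<close>

definition inv_sqrt_log :: "real \<Rightarrow> real" where
  "inv_sqrt_log \<epsilon> = (if \<epsilon> = 0 then 0 else 1 / sqrt (ln (1 / \<epsilon>)))"

end

theory Submission
  imports Defs
begin

text \<open>
  The bound is a two-point argument. Fix \<open>\<epsilon>\<close> and \<open>\<lambda>\<close>, and write \<open>p\<^sub>\<lambda>\<close> for the Poisson mass
  function. Since \<open>\<epsilon> \<le> \<epsilon>max\<close>, every contaminated law at level \<open>\<epsilon>\<close> is also one at level
  \<open>\<epsilon>max\<close> (\<open>contaminated_mono\<close>), so under it a valid interval covers \<open>\<lambda>\<close> with probability at
  least \<open>1 - \<alpha>\<close>. If the law of one observation is moreover within \<open>1/(4n)\<close> of a law at level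
  \<open>\<epsilon>max\<close> with rate \<open>\<lambda>'\<close>, the interval also covers \<open>\<lambda>'\<close> with probability at least
  \<open>1 - \<alpha> - 1/4\<close>. Both rates are then covered with probability at least \<open>3/4 - 2\<alpha> > \<alpha>\<close>, and the
  optimal length is at least \<open>|\<lambda> - \<lambda>'|\<close> (\<open>optimal_length_ge_two_point\<close>).

  Suitable contaminating laws exist as soon as the positive part of
  \<open>(1 - \<epsilon>max) p\<^sub>\<lambda>\<^sub>' - (1 - \<epsilon>) p\<^sub>\<lambda>\<close> has total mass at most \<open>\<epsilon> + 1/(4n)\<close>: the excess is
  filled in by the contamination at level \<open>\<epsilon>\<close>, and what remains unmatched by \<open>p\<^sub>\<lambda>\<^sub>'\<close> is filled
  in at level \<open>\<epsilon>max\<close> (\<open>exists_contaminants\<close>).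

  Put \<open>D = ln (1 + \<epsilon>max/2)\<close>. Then \<open>(1 - \<epsilon>max) e\<^sup>D \<le> 1 - \<epsilon>/2\<close>, so wherever
  \<open>p\<^sub>\<lambda>\<^sub>' \<le> e\<^sup>D p\<^sub>\<lambda>\<close> the excess is at most \<open>(\<epsilon>/2) p\<^sub>\<lambda>\<close>, which costs only half of the
  budget \<open>\<epsilon>\<close>. Three choices of \<open>\<lambda>'\<close> give the three parts of the bound.

  \<^item> \<open>\<lambda>' = \<lambda> + \<epsilon> + 1/(4n)\<close>: a shift by \<open>t\<close> moves at most \<open>1 - e\<^sup>-\<^sup>t \<le> t\<close> of the mass.
  \<^item> \<open>\<lambda>' = \<lambda> - min D \<lambda>\<close>: here \<open>p\<^sub>\<lambda>\<^sub>' \<le> e\<^sup>D p\<^sub>\<lambda>\<close> everywhere. This gives the term \<open>min 1 \<lambda>\<close>.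
  \<^item> \<open>\<lambda>' = \<lambda> - t\<close> with \<open>t\<close> of order \<open>min (\<surd>\<lambda>/\<surd>L) \<lambda>\<close>, where \<open>L = ln (1/m)\<close> and
    \<open>m = \<epsilon>/2 + 1/(4n)\<close>. The likelihood ratio exceeds \<open>e\<^sup>D\<close> only at counts below
    \<open>\<lambda> - D\<lambda>/t\<close>, that is, at a distance of at least the order of \<open>\<surd>(\<lambda>L)\<close> below the mean, and by Chernoff's
    bound this event has probability at most \<open>e\<^sup>-\<^sup>L = m\<close>. As \<open>L\<close> is bounded by constant
    multiples of \<open>ln n\<close> and of \<open>ln (1/\<epsilon>)\<close>, this gives the logarithmic terms.
\<close>

section \<open>Contaminating laws that match two mass functions\<close>

lemma pmf_nat_sums_1: "pmf (p :: nat pmf) sums 1"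
proof -
  have "(\<Sum>k. ennreal (pmf p k)) = emeasure (measure_pmf p) UNIV"
    by (simp only: nn_integral_pmf[symmetric] nn_integral_count_space_nat)
  also have "\<dots> = 1"
    using measure_pmf.emeasure_space_1[of p] by (simp only: space_measure_pmf)
  finally have "(\<lambda>k. ennreal (pmf p k)) sums ennreal 1"
    using summable_sums[OF summableI, of "\<lambda>k. ennreal (pmf p k)"] by simp
  then show ?thesis
    using sums_ennreal[of "pmf p" 1] by simp
qed

lemma exists_pmf_normalized:
  fixes f :: "nat \<Rightarrow> real"
  assumes "\<And>k. f k \<ge> 0" "f sums s" "s > 0"
  shows "\<exists>q. \<forall>k. pmf q k = f k / s"
proof -
  have "(\<lambda>k. f k / s) sums 1"
    using sums_divide[OF assms(2), of s] assms(3) by simp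
  then have "(\<lambda>k. ennreal (f k / s)) sums ennreal 1"
    using assms by (subst sums_ennreal) auto
  then have "(\<integral>\<^sup>+ k. ennreal (f k / s) \<partial>count_space UNIV) = 1"
    by (simp add: nn_integral_count_space_nat sums_iff)
  then have "pmf (embed_pmf (\<lambda>k. f k / s)) k = f k / s" for k
    using assms by (intro pmf_embed_pmf) auto
  then show ?thesis by blast
qed

text \<open>
  If \<open>(1 - e') p'\<close> exceeds \<open>(1 - e) p\<close> by a function of total mass at most \<open>e + \<tau>\<close>, then
  contaminating laws \<open>q\<close> at level \<open>e\<close> and \<open>q'\<close> at level \<open>e'\<close> bring the two mixtures within
  \<open>\<tau>\<close> of each other in total variation; \<open>d\<close> dominates the pointwise excess.
\<close>

lemma exists_contaminants:
  fixes p p' :: "nat pmf" and h :: "nat \<Rightarrow> real"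
  assumes e: "0 \<le> e" "e \<le> 1" and e': "0 < e'" "e' \<le> 1" and "0 \<le> \<tau>"
    and h: "\<And>k. 0 \<le> h k" "h sums H" "H \<le> e + \<tau>"
    and major: "\<And>k. (1 - e') * pmf p' k \<le> (1 - e) * pmf p k + h k"
  shows "\<exists>q q' d. (\<forall>k. 0 \<le> d k) \<and> summable d \<and> suminf d \<le> \<tau> \<and>
    (\<forall>k. (1 - e') * pmf p' k + e' * pmf q' k \<le> (1 - e) * pmf p k + e * pmf q k + d k)"
proof -
  have "\<exists>q d. (\<forall>k. 0 \<le> d k) \<and> summable d \<and> suminf d \<le> \<tau> \<and> (\<forall>k. h k \<le> e * pmf q k + d k)"
  proof (cases "H > 0")
    case True
    \<comment> \<open>\<open>e * q\<close> absorbs the share \<open>e / H\<close> of the excess; the rest has mass at most \<open>\<tau>\<close>.\<close>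
    obtain q where q: "\<And>k. pmf q k = h k / H"
      using exists_pmf_normalized[OF h(1,2) True] by blast
    define w where "w = max 0 (1 - e / H)"
    have "(\<lambda>k. w * h k) sums (w * H)" using h(2) by (rule sums_mult)
    moreover have "w * H \<le> \<tau>"
    proof (cases "e \<le> H")
      case True
      then have "w * H = H - e"
        using \<open>H > 0\<close> by (simp add: w_def max_def field_simps)
      then show ?thesis using h(3) by simp
    next
      case False
      then have "w = 0" using \<open>H > 0\<close> by (simp add: w_def max_def field_simps)
      then show ?thesis using \<open>0 \<le> \<tau>\<close> by simp
    qed
    moreover have "h k \<le> e * pmf q k + w * h k" for k
    proof -
      have "1 * h k \<le> (e / H + w) * h k"
        using h(1) by (intro mult_right_mono) (auto simp: w_def)
      then show ?thesis by (simp add: q algebra_simps)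
    qed
    moreover have "0 \<le> w" by (simp add: w_def)
    ultimately show ?thesis
      using h(1) by (intro exI[of _ q] exI[of _ "\<lambda>k. w * h k"]) (auto simp: sums_iff)
  next
    case False
    then have "h k \<le> 0" for k
      using sum_le_suminf[of h "{k}"] h(1,2) by (auto simp: sums_iff)
    moreover have "0 \<le> e * pmf p k" for k using e by simp
    ultimately have "h k \<le> e * pmf p k" for k by (meson order_trans)
    then show ?thesis
      using \<open>0 \<le> \<tau>\<close> by (intro exI[of _ p] exI[of _ "\<lambda>_. 0"]) auto
  qed
  then obtain q d where d: "\<And>k. 0 \<le> d k" "summable d" "suminf d \<le> \<tau>"
      and hq: "\<And>k. h k \<le> e * pmf q k + d k"
    by blast
  \<comment> \<open>\<open>q'\<close> is the normalised positive part \<open>v\<close> of \<open>P - g\<close>. The mass of \<open>v\<close> is at least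
    \<open>e'\<close>, so \<open>g + e' * q'\<close> stays below the maximum of \<open>P\<close> and \<open>g\<close>.\<close>
  define P where "P k = (1 - e) * pmf p k + e * pmf q k" for k
  define g where "g k = (1 - e') * pmf p' k" for k
  define v where "v k = max 0 (P k - g k)" for k
  have P: "P sums 1"
    unfolding P_def using sums_add[OF sums_mult[OF pmf_nat_sums_1, of "1 - e" p]
      sums_mult[OF pmf_nat_sums_1, of e q]] by simp
  have g: "g sums (1 - e')"
    unfolding g_def using sums_mult[OF pmf_nat_sums_1, of "1 - e'" p'] by simp
  have nonneg: "P k \<ge> 0" "g k \<ge> 0" for k
    using e e' by (auto simp: P_def g_def)
  have "summable v"
  proof (rule summable_comparison_test')
    show "summable P" using P by (simp add: sums_iff)
    show "norm (v k) \<le> P k" if "k \<ge> 0" for k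
      using nonneg[of k] by (auto simp: v_def)
  qed
  then have v: "v sums suminf v" by (rule summable_sums)
  have "1 - (1 - e') \<le> suminf v"
    by (rule sums_le[OF _ sums_diff[OF P g] v]) (auto simp: v_def)
  then have M: "e' \<le> suminf v" by simp
  obtain q' where q': "\<And>k. pmf q' k = v k / suminf v"
    using exists_pmf_normalized[OF _ v] M e' by (auto simp: v_def)
  have "g k + e' * pmf q' k \<le> P k + d k" for k
  proof -
    have "e' * pmf q' k = (e' / suminf v) * v k" by (simp add: q')
    also have "\<dots> \<le> 1 * v k"
      using M e' by (intro mult_right_mono) (auto simp: v_def)
    finally have "e' * pmf q' k \<le> v k" by simp
    moreover have "g k \<le> P k + d k"
      using major[of k] hq[of k] by (simp add: g_def P_def)
    ultimately show ?thesis using d(1)[of k] by (auto simp: v_def max_def split: if_splits)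
  qed
  then show ?thesis using d unfolding P_def g_def by blast
qed

section \<open>Contaminated Poisson laws\<close>

text \<open>A distribution on the natural numbers, seen as a Borel measure on the real line.\<close>

definition lattice_distribution :: "nat pmf \<Rightarrow> real measure" where
  "lattice_distribution q = distr (measure_pmf q) borel real"

lemma lattice_distribution_in_distributions: "lattice_distribution q \<in> real_distributions"
  by (auto simp: real_distributions_def lattice_distribution_def
      intro!: prob_space.prob_space_distr prob_space_measure_pmf)

lemma contaminated_lattice:
  assumes "0 \<le> e" "e \<le> 1"
  shows "contaminated e lam (lattice_distribution q) =
    distr (density (count_space UNIV)
      (\<lambda>k. ennreal ((1 - e) * pmf (poisson0_pmf lam) k + e * pmf q k))) borel real"
    (is "_ = distr ?D _ _")
proof (rule measure_eqI)
  fix A assume "A \<in> sets (contaminated e lam (lattice_distribution q))"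
  then have A: "A \<in> sets borel" by simp
  have pmf: "emeasure (distr (measure_pmf r) borel real) A =
      (\<integral>\<^sup>+ k. ennreal (pmf r k) * indicator (real -` A) k \<partial>count_space UNIV)" for r
    using A nn_integral_measure_pmf[of r "indicator (real -` A)"] by (simp add: emeasure_distr)
  have "emeasure (distr ?D borel real) A =
      (\<integral>\<^sup>+ k. ennreal ((1 - e) * pmf (poisson0_pmf lam) k + e * pmf q k)
        * indicator (real -` A) k \<partial>count_space UNIV)"
    using A by (simp add: emeasure_distr emeasure_density)
  also have "\<dots> = (\<integral>\<^sup>+ k. ennreal (1 - e) * (ennreal (pmf (poisson0_pmf lam) k) * indicator (real -` A) k)
      + ennreal e * (ennreal (pmf q k) * indicator (real -` A) k) \<partial>count_space UNIV)"
    using assms by (intro nn_integral_cong) (auto simp: ennreal_mult' split: split_indicator)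
  also have "\<dots> = emeasure (contaminated e lam (lattice_distribution q)) A"
    by (subst emeasure_contaminated[OF lattice_distribution_in_distributions A])
      (simp add: nn_integral_add nn_integral_cmult poisson_measure_def lattice_distribution_def pmf)
  finally show "emeasure (contaminated e lam (lattice_distribution q)) A =
    emeasure (distr ?D borel real) A" ..
qed simp

lemma nn_integral_contaminated_lattice:
  assumes "0 \<le> e" "e \<le> 1" "\<phi> \<in> borel_measurable borel"
  shows "(\<integral>\<^sup>+ x. \<phi> x \<partial>contaminated e lam (lattice_distribution q)) =
    (\<integral>\<^sup>+ k. ennreal ((1 - e) * pmf (poisson0_pmf lam) k + e * pmf q k) * \<phi> (real k) \<partial>count_space UNIV)"
  using assms by (simp add: contaminated_lattice nn_integral_distr nn_integral_density)

lemma contaminated_mono: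
  assumes Q: "Q \<in> real_distributions" and e: "0 \<le> e" "e \<le> e'" "0 < e'" "e' \<le> 1"
  shows "\<exists>Q'\<in>real_distributions. contaminated e lam Q = contaminated e' lam Q'"
proof
  let ?Q' = "contaminated (e / e') lam Q"
  show Q': "?Q' \<in> real_distributions"
    using assms by (intro contaminated_in_distributions) auto
  show "contaminated e lam Q = contaminated e' lam ?Q'"
  proof (rule measure_eqI)
    fix A assume "A \<in> sets (contaminated e lam Q)"
    then have A: "A \<in> sets borel" by simp
    let ?p = "emeasure (poisson_measure lam) A" and ?q = "emeasure Q A"
    have "ennreal (1 - e') + ennreal e' * ennreal (1 - e / e') = ennreal (1 - e)"
      using e by (simp add: field_simps flip: ennreal_mult ennreal_plus)
    moreover have "ennreal e' * ennreal (e / e') = ennreal e"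
      using e by (simp flip: ennreal_mult)
    moreover have "ennreal (1 - e') * ?p + ennreal e' * (ennreal (1 - e / e') * ?p + ennreal (e / e') * ?q)
       = (ennreal (1 - e') + ennreal e' * ennreal (1 - e / e')) * ?p + (ennreal e' * ennreal (e / e')) * ?q"
      by (simp add: algebra_simps)
    ultimately show "emeasure (contaminated e lam Q) A = emeasure (contaminated e' lam ?Q') A"
      by (simp add: emeasure_contaminated[OF Q A] emeasure_contaminated[OF Q' A])
  qed simp
qed

section \<open>The two-point bound\<close>

text \<open>
  Closeness of two laws tensorises: the errors \<open>\<tau>\<close> add up over the coordinates. The statement
  is about functions with values in \<open>[0, 1]\<close> rather than about events, since integrating out
  one coordinate of an event leaves such a function.
\<close>

lemma nn_integral_PiM_le:
  fixes P P' :: "'a measure" and I :: "'i set" and \<tau> :: real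
  assumes P: "prob_space P" and P': "prob_space P'" and sets: "sets P' = sets P"
    and close: "\<And>\<phi> :: 'a \<Rightarrow> ennreal. \<phi> \<in> borel_measurable P \<Longrightarrow> (\<And>x. \<phi> x \<le> 1) \<Longrightarrow>
      (\<integral>\<^sup>+ x. \<phi> x \<partial>P') \<le> (\<integral>\<^sup>+ x. \<phi> x \<partial>P) + ennreal \<tau>"
    and "0 \<le> \<tau>" "finite I"
    and "\<phi> \<in> borel_measurable (Pi\<^sub>M I (\<lambda>_. P))" "\<And>x. \<phi> x \<le> 1"
  shows "(\<integral>\<^sup>+ x. \<phi> x \<partial>Pi\<^sub>M I (\<lambda>_. P')) \<le> (\<integral>\<^sup>+ x. \<phi> x \<partial>Pi\<^sub>M I (\<lambda>_. P)) + ennreal (card I * \<tau>)"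
  using \<open>finite I\<close> assms(7,8)
proof (induction I arbitrary: \<phi> rule: finite_induct)
  case empty
  then show ?case by (simp add: PiM_empty)
next
  case (insert i I)
  interpret P: prob_space P by fact
  interpret P': prob_space P' by fact
  interpret PP: product_sigma_finite "\<lambda>_::'i. P" by standard
  interpret PP': product_sigma_finite "\<lambda>_::'i. P'" by standard
  interpret I': prob_space "Pi\<^sub>M I (\<lambda>_. P')" by (rule prob_space_PiM) (rule P')
  have sPi: "sets (Pi\<^sub>M J (\<lambda>_. P')) = sets (Pi\<^sub>M J (\<lambda>_. P))" for J :: "'i set"
    by (rule sets_PiM_cong) (simp_all add: sets)
  have sp: "space P' = space P" using sets by (rule sets_eq_imp_space_eq)
  have spPi: "space (Pi\<^sub>M I (\<lambda>_. P')) = space (Pi\<^sub>M I (\<lambda>_. P))"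
    by (rule sets_eq_imp_space_eq) (rule sPi)
  have \<phi>': "\<phi> \<in> borel_measurable (Pi\<^sub>M (insert i I) (\<lambda>_. P'))"
    using insert.prems(1) by (simp cong: measurable_cong_sets add: sPi)
  have joint: "(\<lambda>(x, y). \<phi> (x(i := y))) \<in> borel_measurable (Pi\<^sub>M I (\<lambda>_. P) \<Otimes>\<^sub>M P)"
    using measurable_compose[OF measurable_add_dim insert.prems(1)]
    by (simp add: case_prod_beta' fun_upd_def)
  define \<psi> where "\<psi> x = (\<integral>\<^sup>+ y. \<phi> (x(i := y)) \<partial>P)" for x
  have \<psi>: "\<psi> \<in> borel_measurable (Pi\<^sub>M I (\<lambda>_. P))"
    unfolding \<psi>_def using joint by (rule P.borel_measurable_nn_integral)
  have \<psi>': "\<psi> \<in> borel_measurable (Pi\<^sub>M I (\<lambda>_. P'))"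
    using \<psi> by (simp cong: measurable_cong_sets add: sPi)
  have \<psi>1: "\<psi> x \<le> 1" for x
  proof -
    have "\<psi> x \<le> (\<integral>\<^sup>+ y. 1 \<partial>P)"
      unfolding \<psi>_def by (intro nn_integral_mono insert.prems)
    then show ?thesis by (simp add: P.emeasure_space_1)
  qed
  have "(\<integral>\<^sup>+ x. \<phi> x \<partial>Pi\<^sub>M (insert i I) (\<lambda>_. P')) =
      (\<integral>\<^sup>+ x. (\<integral>\<^sup>+ y. \<phi> (x(i := y)) \<partial>P') \<partial>Pi\<^sub>M I (\<lambda>_. P'))"
    using insert.hyps \<phi>' by (intro PP'.product_nn_integral_insert)
  also have "\<dots> \<le> (\<integral>\<^sup>+ x. \<psi> x + ennreal \<tau> \<partial>Pi\<^sub>M I (\<lambda>_. P'))"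
  proof (rule nn_integral_mono)
    fix x assume "x \<in> space (Pi\<^sub>M I (\<lambda>_. P'))"
    then have "x \<in> space (Pi\<^sub>M I (\<lambda>_. P))" by (simp add: spPi)
    then have "(\<lambda>y. \<phi> (x(i := y))) \<in> borel_measurable P"
      using measurable_compose[OF measurable_Pair1'[of x "Pi\<^sub>M I (\<lambda>_. P)" P] joint] by simp
    then show "(\<integral>\<^sup>+ y. \<phi> (x(i := y)) \<partial>P') \<le> \<psi> x + ennreal \<tau>"
      unfolding \<psi>_def using insert.prems(2) by (rule close)
  qed
  also have "\<dots> = (\<integral>\<^sup>+ x. \<psi> x \<partial>Pi\<^sub>M I (\<lambda>_. P')) + ennreal \<tau>"
    using \<psi>' by (subst nn_integral_add) (auto simp: I'.emeasure_space_1)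
  also have "\<dots> \<le> (\<integral>\<^sup>+ x. \<psi> x \<partial>Pi\<^sub>M I (\<lambda>_. P)) + ennreal (card I * \<tau>) + ennreal \<tau>"
    using \<psi> \<psi>1 by (intro add_right_mono insert.IH)
  also have "\<dots> = (\<integral>\<^sup>+ x. \<psi> x \<partial>Pi\<^sub>M I (\<lambda>_. P)) + ennreal (card (insert i I) * \<tau>)"
    using insert.hyps \<open>0 \<le> \<tau>\<close> by (simp add: algebra_simps flip: ennreal_plus)
  also have "(\<integral>\<^sup>+ x. \<psi> x \<partial>Pi\<^sub>M I (\<lambda>_. P)) = (\<integral>\<^sup>+ x. \<phi> x \<partial>Pi\<^sub>M (insert i I) (\<lambda>_. P))"
    unfolding \<psi>_def using insert.hyps insert.prems(1)
    by (intro PP.product_nn_integral_insert[symmetric])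
  finally show ?case .
qed

lemma interval_length_ge:
  assumes "a \<in> {L..U}" "b \<in> {L..U}"
  shows "\<bar>a - b\<bar> \<le> interval_length L U"
  using assms by (auto simp: interval_length_def)

lemma prob_space_sample_measure:
  assumes "Q \<in> real_distributions" "0 \<le> e" "e \<le> 1"
  shows "prob_space (sample_measure n e lam Q)"
  unfolding sample_measure_def
  using contaminated_in_distributions[OF assms] by (intro prob_space_PiM) (simp add: real_distributions_def)

lemma sets_sample_measure: "sets (sample_measure n e lam Q) = sets (Pi\<^sub>M {..<n} (\<lambda>_. borel))"
  unfolding sample_measure_def by (intro sets_PiM_cong) simp_all

lemma coverage:
  assumes "(l, u) \<in> confidence_intervals n \<alpha> e" "lam \<ge> 0" "Q \<in> real_distributions"
  shows "emeasure (sample_measure n e lam Q) {x \<in> space (sample_measure n e lam Q). lam \<in> {l x..u x}}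
    \<ge> ennreal (1 - \<alpha>)"
  using assms unfolding confidence_intervals_def le_INF_iff by auto

text \<open>
  The condition \<open>3\<alpha> + n\<tau> < 1\<close> says that both rates are covered with probability above
  \<open>\<alpha>\<close>, which rules out every length below their distance.
\<close>

lemma optimal_length_ge_two_point:
  assumes Q: "Q \<in> real_distributions" and Q': "Q' \<in> real_distributions"
    and e: "0 \<le> e" "e \<le> e'" "0 < e'" "e' \<le> 1"
    and lam: "lam \<ge> 0" "lam' \<ge> 0"
    and \<tau>: "0 \<le> \<tau>" "3 * \<alpha> + n * \<tau> < 1" and \<alpha>: "0 \<le> \<alpha>"
    and close: "\<And>\<phi> :: real \<Rightarrow> ennreal. \<phi> \<in> borel_measurable borel \<Longrightarrow> (\<And>x. \<phi> x \<le> 1) \<Longrightarrow>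
      (\<integral>\<^sup>+ x. \<phi> x \<partial>contaminated e' lam' Q') \<le> (\<integral>\<^sup>+ x. \<phi> x \<partial>contaminated e lam Q) + ennreal \<tau>"
  shows "ereal \<bar>lam - lam'\<bar> \<le> optimal_length n \<alpha> e lam e'"
proof -
  define S where "S = sample_measure n e lam Q"
  define S' where "S' = sample_measure n e' lam' Q'"
  interpret S: prob_space S
    unfolding S_def using Q e by (intro prob_space_sample_measure) auto
  interpret S': prob_space S'
    unfolding S'_def using Q' e by (intro prob_space_sample_measure) auto
  have sets: "sets S = sets (Pi\<^sub>M {..<n} (\<lambda>_. borel))" "sets S' = sets (Pi\<^sub>M {..<n} (\<lambda>_. borel))"
    by (simp_all add: S_def S'_def sets_sample_measure)
  have space: "space S' = space S" using sets by (intro sets_eq_imp_space_eq) simp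
  have transfer: "measure S' A \<le> measure S A + n * \<tau>" if A: "A \<in> sets S" for A
  proof -
    have prob: "prob_space (contaminated e lam Q)" "prob_space (contaminated e' lam' Q')"
      using contaminated_in_distributions[OF Q, of e lam] contaminated_in_distributions[OF Q', of e' lam'] e
      by (auto simp: real_distributions_def)
    have "(\<integral>\<^sup>+ x. indicator A x \<partial>S') \<le> (\<integral>\<^sup>+ x. indicator A x \<partial>S) + ennreal (card {..<n} * \<tau>)"
      unfolding S_def S'_def sample_measure_def
    proof (rule nn_integral_PiM_le[OF prob])
      show "indicator A \<in> borel_measurable (Pi\<^sub>M {..<n} (\<lambda>_. contaminated e lam Q))"
        using A by (simp add: S_def sample_measure_def)
    next
      fix \<phi> :: "real \<Rightarrow> ennreal"
      assume "\<phi> \<in> borel_measurable (contaminated e lam Q)" "\<And>x. \<phi> x \<le> 1"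
      then show "(\<integral>\<^sup>+ x. \<phi> x \<partial>contaminated e' lam' Q') \<le> (\<integral>\<^sup>+ x. \<phi> x \<partial>contaminated e lam Q) + ennreal \<tau>"
        by (intro close) (simp_all cong: measurable_cong_sets)
    qed (use \<tau> in \<open>auto simp: indicator_def\<close>)
    then have "emeasure S' A \<le> emeasure S A + ennreal (n * \<tau>)"
      using A sets by simp
    then show ?thesis
      using \<tau> by (simp add: S.emeasure_eq_measure S'.emeasure_eq_measure flip: ennreal_plus)
  qed
  have long: "ennreal (1 - 2 * \<alpha> - n * \<tau>)
      \<le> emeasure S {x \<in> space S. r \<le> interval_length (l x) (u x)}"
    if CI: "(l, u) \<in> confidence_intervals n \<alpha> e'" and r: "r \<le> \<bar>lam - lam'\<bar>" for l u r
  proof -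
    have [measurable]: "l \<in> borel_measurable S" "u \<in> borel_measurable S"
      using CI by (simp_all add: confidence_intervals_def cong: measurable_cong_sets add: sets)
    define A where "A = {x \<in> space S. lam \<in> {l x..u x}}"
    define B where "B = {x \<in> space S. lam' \<in> {l x..u x}}"
    define C where "C = {x \<in> space S. r \<le> interval_length (l x) (u x)}"
    have [measurable]: "A \<in> sets S" "B \<in> sets S"
      unfolding A_def B_def atLeastAtMost_iff by measurable
    have [measurable]: "C \<in> sets S"
      unfolding C_def interval_length_def by measurable
    \<comment> \<open>At level \<open>e'\<close> the law of the sample is admissible for the rate \<open>lam\<close>.\<close>
    obtain Q0 where Q0: "Q0 \<in> real_distributions" "contaminated e lam Q = contaminated e' lam Q0"
      using contaminated_mono[OF Q e] by blast
    have S0: "S = sample_measure n e' lam Q0"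
      by (simp add: S_def sample_measure_def Q0(2))
    have "ennreal (1 - \<alpha>) \<le> emeasure S A"
      using coverage[OF CI lam(1) Q0(1)] by (simp add: A_def S0)
    then have PA: "1 - \<alpha> \<le> measure S A"
      by (simp add: S.emeasure_eq_measure)
    have "ennreal (1 - \<alpha>) \<le> emeasure S' B"
      using coverage[OF CI lam(2) Q'] by (simp add: B_def S'_def flip: space)
    then have "1 - \<alpha> \<le> measure S' B"
      by (simp add: S'.emeasure_eq_measure)
    then have PB: "1 - \<alpha> - n * \<tau> \<le> measure S B"
      using transfer[of B] by simp
    have "measure S A + measure S B - 1 \<le> measure S (A \<inter> B)"
      using S.finite_measure_Union'[of A B] S.prob_le_1[of "A \<union> B"]
        S.finite_measure_Diff'[of B A] by (simp add: Int_commute)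
    also have "\<dots> \<le> measure S C"
    proof (rule S.finite_measure_mono)
      show "A \<inter> B \<subseteq> C"
        using interval_length_ge[of lam _ _ lam'] r by (fastforce simp: A_def B_def C_def)
    qed simp
    finally have "1 - 2 * \<alpha> - n * \<tau> \<le> measure S C" using PA PB by simp
    then show ?thesis unfolding C_def by (simp add: S.emeasure_eq_measure ennreal_leI)
  qed
  have "\<bar>lam - lam'\<bar> \<le> r"
    if r: "(INF (l, u)\<in>confidence_intervals n \<alpha> e'. SUP Q\<in>real_distributions.
        emeasure (sample_measure n e lam Q)
          {x \<in> space (sample_measure n e lam Q). interval_length (l x) (u x) \<ge> r}) \<le> ennreal \<alpha>" for r
  proof (rule ccontr)
    assume "\<not> \<bar>lam - lam'\<bar> \<le> r"
    then have "ennreal (1 - 2 * \<alpha> - n * \<tau>) \<le>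
      (INF (l, u)\<in>confidence_intervals n \<alpha> e'. SUP Q\<in>real_distributions.
        emeasure (sample_measure n e lam Q)
          {x \<in> space (sample_measure n e lam Q). interval_length (l x) (u x) \<ge> r})"
      using long Q unfolding S_def by (intro INF_greatest) (auto intro!: SUP_upper2)
    then have "ennreal (1 - 2 * \<alpha> - n * \<tau>) \<le> ennreal \<alpha>" using r by (rule order_trans)
    then show False using \<tau> \<alpha> by simp
  qed
  then show ?thesis
    unfolding optimal_length_def by (intro Inf_greatest) auto
qed

lemma optimal_length_ge_majorant:
  fixes h :: "nat \<Rightarrow> real"
  assumes e: "0 \<le> e" "e \<le> e'" "0 < e'" "e' \<le> 1"
    and lam: "lam \<ge> 0" "lam' \<ge> 0" and \<alpha>: "0 < \<alpha>" "\<alpha> < 1/4" and n: "n > 0"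
    and h: "\<And>k. 0 \<le> h k" "h sums H" "H \<le> e + 1 / (4 * real n)"
    and major: "\<And>k. (1 - e') * pmf (poisson0_pmf lam') k \<le> (1 - e) * pmf (poisson0_pmf lam) k + h k"
  shows "ereal \<bar>lam - lam'\<bar> \<le> optimal_length n \<alpha> e lam e'"
proof -
  have e1: "e \<le> 1" "0 \<le> e'" using e by auto
  obtain q q' d where d: "\<And>k. 0 \<le> d k" "summable d" "suminf d \<le> 1 / (4 * real n)"
    and qq': "\<And>k. (1 - e') * pmf (poisson0_pmf lam') k + e' * pmf q' k
        \<le> (1 - e) * pmf (poisson0_pmf lam) k + e * pmf q k + d k"
    using exists_contaminants[OF e(1) e1(1) e(3,4) _ h major] by auto
  show ?thesis
  proof (rule optimal_length_ge_two_point[OF lattice_distribution_in_distributions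
        lattice_distribution_in_distributions e lam])
    fix \<phi> :: "real \<Rightarrow> ennreal"
    assume \<phi>: "\<phi> \<in> borel_measurable borel" "\<And>x. \<phi> x \<le> 1"
    let ?P = "\<lambda>k. (1 - e) * pmf (poisson0_pmf lam) k + e * pmf q k"
    have "(\<integral>\<^sup>+ x. \<phi> x \<partial>contaminated e' lam' (lattice_distribution q'))
        \<le> (\<integral>\<^sup>+ k. ennreal (?P k) * \<phi> (real k) + ennreal (d k) \<partial>count_space UNIV)"
      unfolding nn_integral_contaminated_lattice[OF e1(2) e(4) \<phi>(1)]
    proof (rule nn_integral_mono)
      fix k
      have "ennreal ((1 - e') * pmf (poisson0_pmf lam') k + e' * pmf q' k) * \<phi> (real k)
          \<le> (ennreal (?P k) + ennreal (d k)) * \<phi> (real k)"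
        using qq'[of k] d(1)[of k] e e1
        by (intro mult_right_mono) (auto simp flip: ennreal_plus intro!: ennreal_leI)
      also have "\<dots> \<le> ennreal (?P k) * \<phi> (real k) + ennreal (d k) * 1"
        unfolding distrib_right by (intro add_left_mono mult_left_mono \<phi>) simp
      finally show "ennreal ((1 - e') * pmf (poisson0_pmf lam') k + e' * pmf q' k) * \<phi> (real k)
          \<le> ennreal (?P k) * \<phi> (real k) + ennreal (d k)" by simp
    qed
    also have "\<dots> = (\<integral>\<^sup>+ x. \<phi> x \<partial>contaminated e lam (lattice_distribution q)) + (\<Sum>k. ennreal (d k))"
      unfolding nn_integral_contaminated_lattice[OF e(1) e1(1) \<phi>(1)]
      by (subst nn_integral_add) (auto simp: nn_integral_count_space_nat)
    also have "(\<Sum>k. ennreal (d k)) = ennreal (suminf d)"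
      using d by (intro suminf_ennreal2) auto
    also have "\<dots> \<le> ennreal (1 / (4 * real n))"
      using d(3) by (rule ennreal_leI)
    finally show "(\<integral>\<^sup>+ x. \<phi> x \<partial>contaminated e' lam' (lattice_distribution q'))
      \<le> (\<integral>\<^sup>+ x. \<phi> x \<partial>contaminated e lam (lattice_distribution q)) + ennreal (1 / (4 * real n))"
      by (simp add: add_left_mono)
  qed (use n \<alpha> in auto)
qed

section \<open>Poisson mass functions with different rates\<close>

lemma pmf_poisson0_shift:
  assumes "0 \<le> \<mu>" "0 \<le> t"
  shows "exp (- t) * pmf (poisson0_pmf \<mu>) k \<le> pmf (poisson0_pmf (\<mu> + t)) k"
proof -
  have "\<mu> ^ k \<le> (\<mu> + t) ^ k" using assms by (intro power_mono) auto
  then have "\<mu> ^ k / fact k * exp (- \<mu> - t) \<le> (\<mu> + t) ^ k / fact k * exp (- \<mu> - t)"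
    by (intro mult_right_mono divide_right_mono) auto
  then show ?thesis
    using assms by (simp add: pmf_poisson0 exp_add[symmetric] exp_minus exp_diff field_simps)
qed

lemma pmf_poisson0_ratio:
  assumes "0 < \<mu>" "0 \<le> t" "t \<le> \<mu>"
  shows "pmf (poisson0_pmf (\<mu> - t)) k \<le> exp (t * (\<mu> - real k) / \<mu>) * pmf (poisson0_pmf \<mu>) k"
proof -
  have "(\<mu> - t) ^ k = \<mu> ^ k * (1 - t / \<mu>) ^ k"
    using assms by (simp add: field_simps flip: power_mult_distrib)
  also have "\<dots> \<le> \<mu> ^ k * exp (- (t / \<mu>)) ^ k"
    using assms exp_ge_add_one_self[of "- (t / \<mu>)"]
    by (intro mult_left_mono power_mono) (auto simp: field_simps)
  also have "\<dots> = \<mu> ^ k * exp (- (real k * t / \<mu>))"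
    by (simp flip: exp_of_nat_mult)
  finally have "(\<mu> - t) ^ k / fact k * exp (t - \<mu>)
      \<le> (\<mu> ^ k * exp (- (real k * t / \<mu>))) / fact k * exp (t - \<mu>)"
    by (intro mult_right_mono divide_right_mono) auto
  also have "\<dots> = \<mu> ^ k / fact k * (exp (- (real k * t / \<mu>)) * exp (t - \<mu>))"
    by simp
  also have "exp (- (real k * t / \<mu>)) * exp (t - \<mu>) = exp (t * (\<mu> - real k) / \<mu>) * exp (- \<mu>)"
    using assms by (simp add: field_simps flip: exp_add)
  finally show ?thesis
    using assms by (simp add: pmf_poisson0 mult_ac)
qed

lemma poisson0_exponential_moment:
  assumes "0 \<le> \<mu>"
  shows "(\<lambda>k. pmf (poisson0_pmf \<mu>) k * exp (\<theta> * (b - real k)))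
    sums exp (\<theta> * b + \<mu> * (exp (- \<theta>) - 1))"
proof -
  have "(\<lambda>k. exp (\<theta> * b - \<mu>) * ((\<mu> * exp (- \<theta>)) ^ k /\<^sub>R fact k))
      sums (exp (\<theta> * b - \<mu>) * exp (\<mu> * exp (- \<theta>)))"
    by (intro sums_mult exp_converges)
  moreover have "exp (\<theta> * b - \<mu>) * ((\<mu> * exp (- \<theta>)) ^ k /\<^sub>R fact k)
      = pmf (poisson0_pmf \<mu>) k * exp (\<theta> * (b - real k))" for k
  proof -
    have "exp (- \<theta>) ^ k = exp (- (\<theta> * real k))"
      by (simp add: mult.commute flip: exp_of_nat_mult)
    moreover have "exp (\<theta> * b - \<mu>) * exp (- (\<theta> * real k)) = exp (- \<mu>) * exp (\<theta> * (b - real k))"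
      by (simp add: algebra_simps flip: exp_add)
    ultimately show ?thesis
      using assms by (simp add: pmf_poisson0 power_mult_distrib divide_inverse mult_ac)
  qed
  moreover have "exp (\<theta> * b - \<mu>) * exp (\<mu> * exp (- \<theta>)) = exp (\<theta> * b + \<mu> * (exp (- \<theta>) - 1))"
    by (simp add: algebra_simps flip: exp_add)
  ultimately show ?thesis by simp
qed

lemma exp_minus_le_quadratic:
  assumes "0 \<le> (x :: real)"
  shows "exp (- x) \<le> 1 - x + x\<^sup>2 / 2"
proof -
  have *: "1 + x + x\<^sup>2 / 2 \<le> exp x"
    using assms by (rule exp_lower_Taylor_quadratic)
  have pos: "0 < 1 - x + x\<^sup>2 / 2"
    using sum_squares_ge_zero[of "x - 1" 0] by (simp add: power2_eq_square algebra_simps)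
  have "1 \<le> 1 + x ^ 4 / 4" by simp
  also have "\<dots> = (1 - x + x\<^sup>2 / 2) * (1 + x + x\<^sup>2 / 2)"
    by (simp add: field_simps power2_eq_square power4_eq_xxxx)
  also have "\<dots> \<le> (1 - x + x\<^sup>2 / 2) * exp x"
    using * pos by (intro mult_left_mono) auto
  finally show ?thesis by (simp add: exp_minus field_simps)
qed

section \<open>Three alternative rates\<close>

text \<open>
  The alternative rate is \<open>lam + e + 1 / (4n)\<close> in the first bound and \<open>lam - t\<close> in the other
  two. In the last one \<open>\<theta>\<close> is the free parameter of Chernoff's bound for the event that the count
  is below \<open>lam - D * lam / t\<close>, where \<open>D = ln (1 + e' / 2)\<close>; the hypothesis on \<open>\<theta>\<close>
  makes the probability of this event at most \<open>e / 2 + 1 / (4n)\<close>.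
\<close>

lemma
  fixes e e' lam \<alpha> D :: real
  assumes e: "0 \<le> e" "e \<le> e'" "0 < e'" "e' \<le> 1" and lam: "0 \<le> lam"
    and \<alpha>: "0 < \<alpha>" "\<alpha> < 1/4" and n: "n > 0"
  shows optimal_length_ge_noise: "ereal (e + 1 / (4 * real n)) \<le> optimal_length n \<alpha> e lam e'"
    and optimal_length_ge_bounded_ratio:
      "0 \<le> t \<Longrightarrow> t \<le> ln (1 + e' / 2) \<Longrightarrow> t \<le> lam \<Longrightarrow> ereal t \<le> optimal_length n \<alpha> e lam e'"
    and optimal_length_ge_tail:
      "0 < t \<Longrightarrow> t \<le> lam \<Longrightarrow> 0 \<le> \<theta> \<Longrightarrow>
       \<theta> * (t - ln (1 + e' / 2) * lam / t) + lam * \<theta>\<^sup>2 / 2 \<le> ln (e / 2 + 1 / (4 * real n)) \<Longrightarrow>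
       ereal t \<le> optimal_length n \<alpha> e lam e'"
proof -
  let ?p = "\<lambda>\<mu>. pmf (poisson0_pmf \<mu>)"
  define D where "D = ln (1 + e' / 2)"
  have slack: "(1 - e') * exp D \<le> 1 - e / 2"
  proof -
    have "exp D = 1 + e' / 2" using e by (simp add: D_def)
    then have "(1 - e') * exp D = (1 - e') * (1 + e' / 2)" by simp
    also have "\<dots> = 1 - e' / 2 - e' * e' / 2" by (simp add: field_simps)
    finally have "(1 - e') * exp D = 1 - e' / 2 - e' * e' / 2" .
    moreover have "0 \<le> e' * e'" by simp
    ultimately show ?thesis using e by linarith
  qed
  have le_p: "(1 - e') * y \<le> (1 - e) * ?p lam k + e / 2 * ?p lam k" if "y \<le> exp D * ?p lam k" for y k
  proof -
    have "(1 - e') * y \<le> (1 - e') * (exp D * ?p lam k)"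
      using e that by (intro mult_left_mono) auto
    also have "\<dots> \<le> (1 - e / 2) * ?p lam k"
      using slack by (simp add: mult_right_mono flip: mult.assoc)
    finally show ?thesis by (simp add: algebra_simps)
  qed
  have half: "(\<lambda>k. e / 2 * ?p lam k) sums (e / 2)"
    using sums_mult[OF pmf_nat_sums_1, of "e / 2"] by simp
  show "ereal (e + 1 / (4 * real n)) \<le> optimal_length n \<alpha> e lam e'"
  proof -
    let ?t = "e + 1 / (4 * real n)"
    have t: "0 \<le> ?t" using e by simp
    have "ereal \<bar>lam - (lam + ?t)\<bar> \<le> optimal_length n \<alpha> e lam e'"
    proof (rule optimal_length_ge_majorant[OF e lam _ \<alpha> n])
      show "(\<lambda>k. ?p (lam + ?t) k - exp (- ?t) * ?p lam k) sums (1 - exp (- ?t) * 1)"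
        by (intro sums_diff sums_mult pmf_nat_sums_1)
      show "1 - exp (- ?t) * 1 \<le> ?t"
        using exp_ge_add_one_self[of "- ?t"] by linarith
      show "0 \<le> ?p (lam + ?t) k - exp (- ?t) * ?p lam k" for k
        using pmf_poisson0_shift[OF lam t] by simp
      show "(1 - e') * ?p (lam + ?t) k \<le> (1 - e) * ?p lam k + (?p (lam + ?t) k - exp (- ?t) * ?p lam k)" for k
      proof -
        have "(1 - e') * (?p (lam + ?t) k - exp (- ?t) * ?p lam k)
            \<le> 1 * (?p (lam + ?t) k - exp (- ?t) * ?p lam k)"
          using e pmf_poisson0_shift[OF lam t] by (intro mult_right_mono) auto
        moreover have "exp (- ?t) \<le> 1"
          using t by (simp only: exp_le_one_iff neg_le_0_iff_le)
        then have "(1 - e') * exp (- ?t) * ?p lam k \<le> (1 - e) * 1 * ?p lam k"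
          using e by (intro mult_right_mono mult_mono) auto
        ultimately show ?thesis by (simp add: algebra_simps)
      qed
      show "0 \<le> lam + ?t" using lam t by linarith
    qed
    then show ?thesis using t by (simp add: add.commute)
  qed
  show "ereal t \<le> optimal_length n \<alpha> e lam e'" if t: "0 \<le> t" "t \<le> ln (1 + e' / 2)" "t \<le> lam"
  proof -
    have "ereal \<bar>lam - (lam - t)\<bar> \<le> optimal_length n \<alpha> e lam e'"
    proof (rule optimal_length_ge_majorant[OF e lam _ \<alpha> n _ half])
      show "(1 - e') * ?p (lam - t) k \<le> (1 - e) * ?p lam k + e / 2 * ?p lam k" for k
      proof (rule le_p)
        have "?p (lam - t) k \<le> exp t * ?p lam k"
          using pmf_poisson0_shift[of "lam - t" t k] t by (simp add: exp_minus field_simps)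
        also have "\<dots> \<le> exp D * ?p lam k"
          using t by (intro mult_right_mono) (auto simp: D_def)
        finally show "?p (lam - t) k \<le> exp D * ?p lam k" .
      qed
    qed (use e t in \<open>auto intro: add_increasing2\<close>)
    then show ?thesis using t by simp
  qed
  show "ereal t \<le> optimal_length n \<alpha> e lam e'"
    if t: "0 < t" "t \<le> lam" and \<theta>: "0 \<le> \<theta>"
      and small: "\<theta> * (t - ln (1 + e' / 2) * lam / t) + lam * \<theta>\<^sup>2 / 2 \<le> ln (e / 2 + 1 / (4 * real n))"
  proof -
    define b where "b = lam - D * lam / t"
    let ?tail = "\<lambda>k. ?p (lam - t) k * exp (\<theta> * (b - real k))"
    have lam0: "0 < lam" using t by simp
    have "ereal \<bar>lam - (lam - t)\<bar> \<le> optimal_length n \<alpha> e lam e'"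
    proof (rule optimal_length_ge_majorant[OF e lam _ \<alpha> n])
      show "(\<lambda>k. e / 2 * ?p lam k + ?tail k) sums (e / 2 + exp (\<theta> * b + (lam - t) * (exp (- \<theta>) - 1)))"
        using t by (intro sums_add half poisson0_exponential_moment) simp
      have "\<theta> * b + (lam - t) * (exp (- \<theta>) - 1) \<le> \<theta> * b + (lam - t) * (- \<theta> + \<theta>\<^sup>2 / 2)"
        using t exp_minus_le_quadratic[OF \<theta>] by (intro add_left_mono mult_left_mono) auto
      also have "\<dots> = \<theta> * (t - D * lam / t) + (lam - t) * \<theta>\<^sup>2 / 2"
        by (simp add: b_def algebra_simps)
      also have "\<dots> \<le> \<theta> * (t - D * lam / t) + lam * \<theta>\<^sup>2 / 2"
        using t by (intro add_left_mono divide_right_mono mult_right_mono) auto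
      also have "\<dots> \<le> ln (e / 2 + 1 / (4 * real n))"
        using small by (simp add: D_def)
      finally have "exp (\<theta> * b + (lam - t) * (exp (- \<theta>) - 1)) \<le> exp (ln (e / 2 + 1 / (4 * real n)))"
        by simp
      moreover have "0 < e / 2 + 1 / (4 * real n)" using e n by (simp add: add_nonneg_pos)
      ultimately show "e / 2 + exp (\<theta> * b + (lam - t) * (exp (- \<theta>) - 1)) \<le> e + 1 / (4 * real n)"
        by simp
      show "(1 - e') * ?p (lam - t) k \<le> (1 - e) * ?p lam k + (e / 2 * ?p lam k + ?tail k)" for k
      \<comment> \<open>Below \<open>b\<close> the exponential factor is at least \<open>1\<close>; above it the likelihood ratio is
        at most \<open>exp D\<close>.\<close>
      proof (cases "real k \<le> b")
        case True
        have "(1 - e') * ?p (lam - t) k \<le> 1 * ?p (lam - t) k"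
          using e by (intro mult_right_mono) auto
        also have "\<dots> \<le> ?tail k"
          using True \<theta> mult_left_mono[of 1 "exp (\<theta> * (b - real k))" "?p (lam - t) k"] by simp
        finally have "(1 - e') * ?p (lam - t) k \<le> ?tail k" .
        moreover have "0 \<le> (1 - e) * ?p lam k + e / 2 * ?p lam k"
          using e by simp
        ultimately show ?thesis by linarith
      next
        case False
        have "t * (lam - real k) / lam \<le> D"
          using False t lam0 by (simp add: b_def field_simps)
        then have "exp (t * (lam - real k) / lam) * ?p lam k \<le> exp D * ?p lam k"
          by (intro mult_right_mono) auto
        then have "?p (lam - t) k \<le> exp D * ?p lam k"
          using pmf_poisson0_ratio[OF lam0 _ t(2), of k] t by simp
        from le_p[OF this] show ?thesis
          by (simp add: add_increasing2 flip: add.assoc)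
      qed
      show "0 \<le> e / 2 * ?p lam k + ?tail k" for k
        using e by simp
    qed (use t in auto)
    then show ?thesis using t by simp
  qed
qed

section \<open>Lower bound on the locally optimal length\<close>

lemma min_add_le:
  fixes a b c :: real
  assumes "0 \<le> a" "0 \<le> b" "0 \<le> c"
  shows "min (a + b) c \<le> min a c + min b c"
  using assms by (auto simp: min_def)

theorem theorem7:
  fixes \<alpha> \<epsilon>max :: real
  assumes "0 < \<alpha>" "\<alpha> < 1/4" "0 \<le> \<epsilon>max" "\<epsilon>max \<le> 1/2"
  shows "\<exists>c::real. c > 0 \<and>
    (\<forall>n::nat. n \<ge> 3 \<longrightarrow> \<epsilon>max \<ge> 2 * \<alpha> / real n \<longrightarrow>
      (\<forall>\<epsilon>::real. 0 \<le> \<epsilon> \<and> \<epsilon> \<le> \<epsilon>max \<longrightarrow>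
        (\<forall>lam::real. lam \<ge> 0 \<longrightarrow>
          optimal_length n \<alpha> \<epsilon> lam \<epsilon>max \<ge>
            ereal (c * (min (sqrt lam * (1 / sqrt (ln (real n)) + inv_sqrt_log \<epsilon>) + 1) lam
                        + 1 / real n + \<epsilon>)))))"
proof (cases "\<epsilon>max = 0")
  \<comment> \<open>Without contamination no sample size satisfies \<open>\<epsilon>max \<ge> 2\<alpha>/n\<close>.\<close>
  case True
  have "\<not> 2 * \<alpha> / real n \<le> \<epsilon>max" if "n \<ge> 3" for n :: nat
    using True that assms(1) by (simp add: field_simps)
  then show ?thesis by (intro exI[of _ 1]) auto
next
  case False
  define D where "D = ln (1 + \<epsilon>max / 2)"
  have D: "0 < D" "D \<le> 1 / 4"
    using False assms ln_add_one_self_le_self[of "\<epsilon>max / 2"] by (auto simp: D_def)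
  show ?thesis
  proof (intro exI[of _ "D / 10"] conjI allI impI)
    show "0 < D / 10" using D by simp
  next
    fix n :: nat and \<epsilon> lam :: real
    assume n: "3 \<le> n" and "0 \<le> \<epsilon> \<and> \<epsilon> \<le> \<epsilon>max" and lam: "0 \<le> lam"
    then have \<epsilon>: "0 \<le> \<epsilon>" "\<epsilon> \<le> \<epsilon>max" "0 < \<epsilon>max" "\<epsilon>max \<le> 1" "\<epsilon> \<le> 1 / 2"
      and n0: "0 < n" using False assms by auto
    note bounds = optimal_length_ge_noise[OF \<epsilon>(1-4) lam assms(1,2) n0]
      optimal_length_ge_bounded_ratio[OF \<epsilon>(1-4) lam assms(1,2) n0, folded D_def]
      optimal_length_ge_tail[OF \<epsilon>(1-4) lam assms(1,2) n0, folded D_def]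
    let ?opt = "optimal_length n \<alpha> \<epsilon> lam \<epsilon>max"
    define m where "m = \<epsilon> / 2 + 1 / (4 * real n)"
    define L where "L = - ln m"
    have n': "1 / (4 * real n) \<le> 1 / 12" using n by (simp add: field_simps)
    have m: "0 < m" "m \<le> 1 / 3"
      using \<epsilon> n n' unfolding m_def by (auto intro!: add_nonneg_pos, linarith)
    have L1: "1 \<le> L"
    proof -
      have "exp 1 \<le> (3 :: real)" by (rule exp_le)
      then have "1 / 3 \<le> exp (- 1 :: real)" by (simp add: exp_minus divide_simps)
      then have "m \<le> exp (- 1)" using m by linarith
      then have "ln m \<le> ln (exp (- 1))" using m by (subst ln_le_cancel_iff) auto
      then show ?thesis by (simp add: L_def)
    qed
    have inv_sqrt_le: "1 / sqrt y \<le> 2 / sqrt L" if "L \<le> 4 * y" for y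
    proof -
      have "sqrt L \<le> sqrt (4 * y)" using that by simp
      moreover have "0 < y" using L1 that by simp
      ultimately show ?thesis using L1 by (simp add: real_sqrt_mult field_simps)
    qed
    have log_n: "1 / sqrt (ln (real n)) \<le> 2 / sqrt L"
    proof (rule inv_sqrt_le)
      have "1 / real n ^ 4 \<le> 1 / (4 * real n)"
      proof -
        have "4 \<le> real n ^ 3" using power_mono[of 3 "real n" 3] n by simp
        then have "4 * real n \<le> real n ^ 3 * real n" by (intro mult_right_mono) auto
        then have "4 * real n \<le> real n ^ 4" by (simp add: eval_nat_numeral mult_ac)
        then show ?thesis using n by (intro divide_left_mono) auto
      qed
      also have "\<dots> \<le> m" using \<epsilon> by (simp add: m_def)
      finally have "ln (1 / real n ^ 4) \<le> ln m" using n m by (subst ln_le_cancel_iff) auto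
      then show "L \<le> 4 * ln (real n)" using n by (simp add: L_def ln_div ln_realpow)
    qed
    have log_\<epsilon>: "inv_sqrt_log \<epsilon> \<le> 2 / sqrt L"
    proof (cases "\<epsilon> = 0")
      case True
      then show ?thesis using L1 by (simp add: inv_sqrt_log_def)
    next
      case False
      \<comment> \<open>This uses \<open>\<epsilon> \<le> 1 / 2\<close>.\<close>
      have "\<epsilon> ^ 4 \<le> \<epsilon> ^ 2" using \<epsilon> by (intro power_decreasing) auto
      also have "\<dots> \<le> \<epsilon> / 2" using \<epsilon> mult_left_mono[of \<epsilon> "1/2" \<epsilon>] by (simp add: power2_eq_square)
      also have "\<dots> \<le> m" by (simp add: m_def)
      finally have "ln (\<epsilon> ^ 4) \<le> ln m" using False \<epsilon> m by (subst ln_le_cancel_iff) auto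
      then have "L \<le> 4 * ln (1 / \<epsilon>)" using False \<epsilon> by (simp add: L_def ln_div ln_realpow)
      then show ?thesis using False inv_sqrt_le by (simp add: inv_sqrt_log_def)
    qed
    define a where "a = sqrt lam / sqrt L"
    have a: "0 \<le> a" using lam L1 by (simp add: a_def)
    define t1 where "t1 = D / 2 * min a lam"
    define t2 where "t2 = min D lam"
    define t3 where "t3 = \<epsilon> + 1 / (4 * real n)"
    have t1: "ereal t1 \<le> ?opt"
    proof (cases "lam = 0")
      case True
      then show ?thesis using bounds(2)[of 0] a D by (simp add: t1_def min_def)
    next
      case False
      then have lam0: "0 < lam" using lam by simp
      \<comment> \<open>\<open>D * lam / t1\<close> is at least \<open>2 * w\<close> and \<open>t1\<close> at most \<open>w / 2\<close>, so the rare event lies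
        at least \<open>3 / 2 * w\<close> below the mean \<open>lam - t1\<close>. This \<open>\<theta>\<close> minimises the quadratic bound on
        the exponent, with value \<open>- 9 / 8 * L\<close>.\<close>
      define w where "w = sqrt lam * sqrt L"
      have w: "0 < w" "w\<^sup>2 = lam * L" using lam0 L1 by (auto simp: w_def power_mult_distrib)
      have aw: "a * w = lam" using lam0 L1 by (simp add: a_def w_def)
      have a0: "0 < a" using lam0 L1 by (simp add: a_def)
      have t: "0 < t1" using D lam0 a0 by (simp add: t1_def)
      have "D / 2 * min a lam \<le> 1 * lam"
        using D lam0 a0 by (intro mult_mono) auto
      then have t_lam: "t1 \<le> lam" by (simp add: t1_def)
      have ta: "t1 \<le> D / 2 * a" using D by (simp add: t1_def)
      have "a \<le> w"
      proof -
        have "a \<le> sqrt lam / 1" unfolding a_def using lam L1 by (intro divide_left_mono) auto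
        also have "\<dots> \<le> w" unfolding w_def using lam L1 mult_left_mono[of 1 "sqrt L" "sqrt lam"] by simp
        finally show ?thesis .
      qed
      then have "D / 2 * a \<le> 1 / 2 * w" using D a by (intro mult_mono) auto
      then have tw: "t1 \<le> w / 2" using ta by simp
      have "2 * w * t1 \<le> 2 * w * (D / 2 * a)" using ta w by (intro mult_left_mono) auto
      also have "\<dots> = D * lam" using aw by (simp add: algebra_simps)
      finally have "2 * w \<le> D * lam / t1" using t by (simp add: field_simps)
      then have gap: "t1 - D * lam / t1 \<le> - (3 / 2 * w)" using tw by simp
      define \<theta> where "\<theta> = 3 / 2 * w / lam"
      have "\<theta> * (t1 - D * lam / t1) + lam * \<theta>\<^sup>2 / 2 \<le> \<theta> * (- (3 / 2 * w)) + lam * \<theta>\<^sup>2 / 2"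
        using gap w lam0 by (intro add_right_mono mult_left_mono) (auto simp: \<theta>_def)
      also have "\<dots> = - (9 / 8) * (w\<^sup>2 / lam)"
        using lam0 by (simp add: \<theta>_def power2_eq_square field_simps)
      also have "\<dots> \<le> ln m" using w lam0 L1 by (simp add: L_def)
      finally show ?thesis
        using bounds(3)[of t1 \<theta>] t t_lam w lam0 by (simp add: m_def \<theta>_def)
    qed
    have t2: "ereal t2 \<le> ?opt"
      using D lam by (intro bounds(2)) (auto simp: t2_def)
    have t3: "ereal t3 \<le> ?opt"
      using bounds(1) by (simp add: t3_def)
    define t where "t = max t1 (max t2 t3)"
    have "ereal t \<le> ?opt" using t1 t2 t3 by (simp add: t_def max_def)
    moreover have "D / 10 * (min (sqrt lam * (1 / sqrt (ln (real n)) + inv_sqrt_log \<epsilon>) + 1) lam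
        + 1 / real n + \<epsilon>) \<le> t"
    proof -
      have "sqrt lam * (1 / sqrt (ln (real n)) + inv_sqrt_log \<epsilon>) \<le> sqrt lam * (2 / sqrt L + 2 / sqrt L)"
        using log_n log_\<epsilon> lam by (intro mult_left_mono add_mono) auto
      also have "\<dots> = 4 * a" by (simp add: a_def)
      finally have "min (sqrt lam * (1 / sqrt (ln (real n)) + inv_sqrt_log \<epsilon>) + 1) lam \<le> min (4 * a + 1) lam"
        by (intro min.mono) auto
      also have "\<dots> \<le> min (4 * a) lam + min 1 lam"
        using a lam by (intro min_add_le) auto
      also have "min (4 * a) lam \<le> 4 * min a lam" using a lam by (auto simp: min_def)
      finally have "D * min (sqrt lam * (1 / sqrt (ln (real n)) + inv_sqrt_log \<epsilon>) + 1) lam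
          \<le> D * (4 * min a lam + min 1 lam)"
        using D by (intro mult_left_mono) auto
      also have "\<dots> = 8 * t1 + D * min 1 lam"
        by (simp add: t1_def distrib_left)
      also have "D * min 1 lam = min D (D * lam)"
        using D by (simp add: min_mult_distrib_left)
      also have "min D (D * lam) \<le> t2"
        unfolding t2_def using D lam mult_right_mono[of D 1 lam] by (intro min.mono) auto
      finally have "D * min (sqrt lam * (1 / sqrt (ln (real n)) + inv_sqrt_log \<epsilon>) + 1) lam \<le> 8 * t1 + t2"
        by simp
      moreover have "D * (1 / real n + \<epsilon>) \<le> t3"
      proof -
        have "D * (1 / real n + \<epsilon>) \<le> 1 / 4 * (1 / real n + \<epsilon>)"
          using D \<epsilon> by (intro mult_right_mono) auto
        moreover have "1 / (4 * real n) = 1 / 4 * (1 / real n)" by simp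
        ultimately show ?thesis using \<epsilon> unfolding t3_def distrib_left by linarith
      qed
      moreover have "t1 \<le> t" "t2 \<le> t" "t3 \<le> t" by (auto simp: t_def)
      ultimately show ?thesis by (simp add: algebra_simps)
    qed
    ultimately show "ereal (D / 10 * (min (sqrt lam * (1 / sqrt (ln (real n)) + inv_sqrt_log \<epsilon>) + 1) lam
        + 1 / real n + \<epsilon>)) \<le> ?opt"
      by (meson ereal_less_eq(3) order_trans)
  qed
qed

end
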